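(* For every $l\in\mathbf N$ there exists a constant $a_l>0$ such that for every lattice $\Lambda$ of $\mathbf R^l$, every $\Omega\in\mathbf R^l$ and every $\delta>0$, $$T(\Lambda,\Omega,\delta)\le\big(\alpha(\Lambda,\Omega,a_l/\delta)\big)^{-1}.$$
   Context: A lattice $\Lambda$ of $\mathbf R^l$ is a discrete subgroup such that $\mathbf R^l/\Lambda$ has finite volume. $T(\Lambda,\Omega,\delta)=\inf\{t\in\mathbf R_+:\ \forall x\in\mathbf R^l,\ d(x,[0,t]\Omega+\Lambda)\le\delta\}$, with $d$ the Euclidean distance and $\inf\emptyset=+\infty$. $\Lambda^*=\{p\in\mathbf R^l:\ p\cdot\lambda\in\mathbf Z\ \forall\lambda\in\Lambda\}$, $\Lambda^*_R=\{p\in\Lambda^*:\ 0<|p|\le R\}$ ($|\cdot|$ Euclidean), and $\alpha(\Lambda,\Omega,R)=\inf\{|p\cdot\Omega|:\ p\in\Lambda^*_R\}$. Convention: $\alpha^{-1}=0$ if $\alpha=+\infty$ and $\alpha^{-1}=+\infty$ if $\alpha=0$. *)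

theory Defs
  imports "HOL-Analysis.Analysis"
begin

text \<open>A lattice of R^l: a discrete additive subgroup such that the quotient R^l / Lambda
  has finite volume, i.e. some Lebesgue measurable set of finite measure covers R^l
  by Lambda-translates.\<close>
definition is_lattice :: "(real ^ 'n) set \<Rightarrow> bool" where
  "is_lattice L \<longleftrightarrow>
     0 \<in> L \<and> (\<forall>x\<in>L. \<forall>y\<in>L. x - y \<in> L) \<and>
     (\<exists>r>0. \<forall>x\<in>L. x \<noteq> 0 \<longrightarrow> norm x \<ge> r) \<and>
     (\<exists>F. F \<in> sets lebesgue \<and> emeasure lebesgue F < \<infinity> \<and>
          (\<forall>x. \<exists>f\<in>F. \<exists>l\<in>L. x = f + l))"

definition orbit_set :: "(real ^ 'n) set \<Rightarrow> real ^ 'n \<Rightarrow> real \<Rightarrow> (real ^ 'n) set" where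
  "orbit_set L \<Omega> t = {s *\<^sub>R \<Omega> + l | s l. s \<in> {0..t} \<and> l \<in> L}"

text \<open>T(Lambda, Omega, delta), valued in the extended reals (Inf of the empty set is +infinity).\<close>
definition Tcov :: "(real ^ 'n) set \<Rightarrow> real ^ 'n \<Rightarrow> real \<Rightarrow> ereal" where
  "Tcov L \<Omega> \<delta> = Inf (ereal ` {t. t \<ge> 0 \<and> (\<forall>x. infdist x (orbit_set L \<Omega> t) \<le> \<delta>)})"

definition dual_lattice :: "(real ^ 'n) set \<Rightarrow> (real ^ 'n) set" where
  "dual_lattice L = {p. \<forall>l\<in>L. p \<bullet> l \<in> \<int>}"

definition dual_ball :: "(real ^ 'n) set \<Rightarrow> real \<Rightarrow> (real ^ 'n) set" where
  "dual_ball L R = {p \<in> dual_lattice L. 0 < norm p \<and> norm p \<le> R}"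

text \<open>alpha(Lambda, Omega, R), in the extended reals (Inf of the empty set is +infinity).\<close>
definition alpha :: "(real ^ 'n) set \<Rightarrow> real ^ 'n \<Rightarrow> real \<Rightarrow> ereal" where
  "alpha L \<Omega> R = Inf ((\<lambda>p. ereal \<bar>p \<bullet> \<Omega>\<bar>) ` dual_ball L R)"

definition inv_conv :: "ereal \<Rightarrow> ereal" where
  "inv_conv a = (if a = \<infinity> then 0 else if a = 0 then \<infinity> else ereal (1 / real_of_ereal a))"

end

theory Submission
  imports Defs
begin

text \<open>
  Put \<open>v = \<Omega> / \<alpha>\<close>. The claim says that the \<open>\<Lambda>\<close>-translates of the convex body
  \<open>[0,v] + B\<^sub>\<delta>\<close> cover space, given \<open>\<bar>q \<bullet> v\<bar> \<ge> 1\<close> for every nonzero dual vector \<open>q\<close> with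
  \<open>\<bar>q\<bar> \<le> a / \<delta>\<close>. A transference theorem, proved by induction on the dimension, gives the
  covering under the stronger hypothesis \<open>\<bar>q \<bullet> v\<bar> \<ge> 2c\<close> for \<open>\<bar>q\<bar> < c / \<delta>\<close>, because the body
  contains an ellipsoid. To replace the constant \<open>2c\<close> by 1, consider radii
  \<open>a\<^sub>0 / \<delta> < a\<^sub>1 / \<delta> < \<dots> < a\<^sub>N / \<delta>\<close>. Either the minimum of \<open>\<bar>q \<bullet> v\<bar>\<close> at least doubles
  each time the radius is lowered by one step, and the transference version applies at \<open>a\<^sub>0\<close>; or,
  after shortening \<open>v\<close>, some \<open>p\<close> of the smaller radius has \<open>1 \<le> p \<bullet> v < 2\<close> while
  \<open>\<bar>q \<bullet> v\<bar> \<ge> 1\<close> on the larger one. In the latter case, for a functional \<open>q\<close> on the hyperplane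
  orthogonal to \<open>p\<close>, the values at \<open>v\<close> of its lifts \<open>q + m p\<close> form an arithmetic progression
  of step less than 2 that avoids \<open>(-1,1)\<close> in a long range of \<open>m\<close>; hence \<open>q \<bullet> v\<close> is large,
  and the transference version applies in that hyperplane.
\<close>

section \<open>Lattices in subspaces, their duals and hyperplane sections\<close>

text \<open>The subspace \<open>V\<close> is a parameter so that inductions on dimension can pass to
  projections and hyperplane sections without changing the type. Full rank is expressed by spanning
  instead of finite covolume.\<close>

definition lattice_in :: "'a::euclidean_space set \<Rightarrow> 'a set \<Rightarrow> bool" where
  "lattice_in V L \<longleftrightarrow> subspace V \<and> span L = V \<and>
     0 \<in> L \<and> (\<forall>x\<in>L. \<forall>y\<in>L. x - y \<in> L) \<and> (\<exists>r>0. \<forall>x\<in>L. x \<noteq> 0 \<longrightarrow> r \<le> norm x)"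

text \<open>The restriction to \<open>V\<close> matters: a vector orthogonal to \<open>V\<close>
  pairs to 0 with all of \<open>L\<close>, so without it the dual of a proper section would not be
  discrete.\<close>

definition dual_in :: "'a::euclidean_space set \<Rightarrow> 'a set \<Rightarrow> 'a set" where
  "dual_in V L = {p \<in> V. \<forall>l\<in>L. p \<bullet> l \<in> \<int>}"

lemma int_scaleR_mem:
  fixes M :: "'a::real_vector set"
  assumes "0 \<in> M" "\<And>x y. x \<in> M \<Longrightarrow> y \<in> M \<Longrightarrow> x - y \<in> M" "x \<in> M"
  shows "of_int k *\<^sub>R x \<in> M"
proof -
  have neg: "- y \<in> M" if "y \<in> M" for y
    using assms(2)[OF assms(1) that] by simp
  have nat: "of_nat n *\<^sub>R x \<in> M" for n
  proof (induction n)
    case (Suc n)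
    have "of_nat n *\<^sub>R x - (- x) \<in> M"
      using assms(2) Suc neg assms(3) by blast
    then show ?case by (simp add: algebra_simps)
  qed (use assms(1) in simp)
  show ?thesis
  proof (cases "k \<ge> 0")
    case True
    then show ?thesis using nat[of "nat k"] by simp
  next
    case False
    then show ?thesis using neg[OF nat[of "nat (-k)"]] by simp
  qed
qed

text \<open>Subtracting an integer multiple of \<open>p\<close> stays in \<open>M\<close> and leaves
  a \<open>p\<close>-coefficient of size at most 1/2. By Pythagoras the projection has squared norm
  at least \<open>r\<^sup>2 - (norm p)\<^sup>2 / 4\<close>, which is at least
  \<open>r\<^sup>2 / 2\<close>.\<close>

lemma norm_projection_ge:
  fixes p q :: "'a::real_inner"
  assumes M: "0 \<in> M" "\<And>x y. x \<in> M \<Longrightarrow> y \<in> M \<Longrightarrow> x - y \<in> M"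
    and r: "0 < r" "\<And>x. x \<in> M \<Longrightarrow> x \<noteq> 0 \<Longrightarrow> r \<le> norm x"
    and p: "p \<in> M" "(norm p)\<^sup>2 \<le> 2 * r\<^sup>2"
    and q: "q \<in> M" "(q + \<gamma> *\<^sub>R p) \<bullet> p = 0" "q + \<gamma> *\<^sub>R p \<noteq> 0"
  shows "r / 2 \<le> norm (q + \<gamma> *\<^sub>R p)"
proof -
  define q0 where "q0 = q + \<gamma> *\<^sub>R p"
  define \<beta> where "\<beta> = \<gamma> - of_int (round \<gamma>)"
  have \<beta>: "\<bar>\<beta>\<bar> \<le> 1/2"
    using of_int_round_abs_le[of \<gamma>] by (simp add: \<beta>_def abs_minus_commute)
  define q' where "q' = q - of_int (- round \<gamma>) *\<^sub>R p"
  have q'M: "q' \<in> M"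
    unfolding q'_def using M int_scaleR_mem[OF M p(1)] q(1) by blast
  have q0: "q' = q0 - \<beta> *\<^sub>R p"
    by (simp add: q'_def q0_def \<beta>_def algebra_simps)
  have orth: "q0 \<bullet> p = 0" "q0 \<noteq> 0" using q by (auto simp: q0_def)
  have nq': "(norm q')\<^sup>2 = (norm q0)\<^sup>2 + \<beta>\<^sup>2 * (norm p)\<^sup>2"
    using orth(1) unfolding q0 power2_norm_eq_inner
    by (simp add: inner_diff_left inner_diff_right inner_commute power2_eq_square)
  have "q' \<noteq> 0"
  proof
    assume "q' = 0"
    then have "(norm q0)\<^sup>2 + \<beta>\<^sup>2 * (norm p)\<^sup>2 = 0" using nq' by simp
    moreover have "0 < (norm q0)\<^sup>2" "0 \<le> \<beta>\<^sup>2 * (norm p)\<^sup>2" using orth(2) by auto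
    ultimately show False by linarith
  qed
  then have "r\<^sup>2 \<le> (norm q')\<^sup>2"
    using r q'M by (intro power_mono) auto
  moreover have "\<beta>\<^sup>2 \<le> 1/4"
    using \<beta> abs_le_square_iff[of \<beta> "1/2"] by (simp add: power2_eq_square)
  then have "\<beta>\<^sup>2 * (norm p)\<^sup>2 \<le> 1/4 * (2 * r\<^sup>2)"
    using p(2) by (intro mult_mono) auto
  ultimately have "r\<^sup>2 / 2 \<le> (norm q0)\<^sup>2" using nq' by linarith
  then have "(r/2)\<^sup>2 \<le> (norm q0)\<^sup>2"
    using order_trans[of "r\<^sup>2 / 4" "r\<^sup>2 / 2"] by (simp add: power_divide)
  then show ?thesis
    unfolding q0_def[symmetric] by (rule power2_le_imp_le) simp
qed

text \<open>Being within a factor \<open>sqrt 2\<close> of the infimum avoids proving that it is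
  attained. The rounding arguments only need the squared ratio to stay below 4, since the rounded
  coefficient is at most 1/2.\<close>

lemma obtain_near_shortest:
  fixes M :: "'a::real_normed_vector set"
  assumes "x \<in> M" "x \<noteq> 0" "0 < r" "\<And>x. x \<in> M \<Longrightarrow> x \<noteq> 0 \<Longrightarrow> r \<le> norm x"
  obtains p s where "p \<in> M" "p \<noteq> 0" "r \<le> s" "\<And>x. x \<in> M \<Longrightarrow> x \<noteq> 0 \<Longrightarrow> s \<le> norm x"
    "(norm p)\<^sup>2 \<le> 2 * s\<^sup>2"
proof -
  define N where "N = norm ` (M - {0})"
  have ne: "N \<noteq> {}" using assms by (auto simp: N_def)
  have bdd: "bdd_below N" unfolding N_def by (rule bdd_belowI[of _ 0]) auto
  have rs: "r \<le> Inf N"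
    by (rule cInf_greatest[OF ne]) (use assms in \<open>auto simp: N_def\<close>)
  then have "Inf N < sqrt 2 * Inf N" using assms(3) by simp
  then obtain p where p: "p \<in> M" "p \<noteq> 0" "norm p < sqrt 2 * Inf N"
    using cInf_lessD[OF ne] by (auto simp: N_def)
  have "(norm p)\<^sup>2 \<le> (sqrt 2 * Inf N)\<^sup>2"
    using p(3) by (intro power_mono) auto
  then have "(norm p)\<^sup>2 \<le> 2 * (Inf N)\<^sup>2" by (simp add: power_mult_distrib)
  moreover have "Inf N \<le> norm x" if "x \<in> M" "x \<noteq> 0" for x
    using bdd that by (intro cInf_lower) (auto simp: N_def)
  ultimately show thesis using that p rs by blast
qed

text \<open>Project \<open>L\<close> along a near-shortest vector \<open>b\<close>; the image stays
  discrete by \<open>norm_projection_ge\<close>. A dual vector of the image is orthogonal to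
  \<open>b\<close>, so it has the same pairings with \<open>L\<close> itself. If the image is zero,
  \<open>L\<close> consists of integer multiples of \<open>b\<close>, and \<open>b\<close> divided
  by \<open>b \<bullet> b\<close> is dual.\<close>

lemma dual_in_nontrivial:
  fixes V L :: "'a::euclidean_space set"
  assumes "lattice_in V L" "V \<noteq> {0}"
  shows "\<exists>p\<in>dual_in V L. p \<noteq> 0"
  using assms
proof (induction "dim V" arbitrary: V L rule: less_induct)
  case less
  have V: "subspace V" "span L = V" and L: "0 \<in> L" "\<And>x y. x \<in> L \<Longrightarrow> y \<in> L \<Longrightarrow> x - y \<in> L"
    using less.prems(1) by (auto simp: lattice_in_def)
  obtain r where r: "r > 0" "\<And>x. x \<in> L \<Longrightarrow> x \<noteq> 0 \<Longrightarrow> r \<le> norm x"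
    using less.prems(1) by (auto simp: lattice_in_def)
  have "\<not> L \<subseteq> {0}"
    using V(2) less.prems(2) span_mono[of L "{0}"] subspace_0[OF V(1)] by auto
  then obtain x where "x \<in> L" "x \<noteq> 0" by auto
  then obtain b s where b: "b \<in> L" "b \<noteq> 0" "r \<le> s" "\<And>x. x \<in> L \<Longrightarrow> x \<noteq> 0 \<Longrightarrow> s \<le> norm x"
    "(norm b)\<^sup>2 \<le> 2 * s\<^sup>2"
    using obtain_near_shortest[of x L r] r by metis
  have s: "s > 0" using b(3) r(1) by simp
  have LV: "L \<subseteq> V" using V(2) span_superset by auto
  have bb: "b \<bullet> b \<noteq> 0" using b(2) by simp
  define \<pi> where "\<pi> = (\<lambda>x. x + (- (x \<bullet> b / (b \<bullet> b))) *\<^sub>R b)"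
  have lin: "linear \<pi>"
    unfolding \<pi>_def by (rule linearI) (auto simp: algebra_simps inner_add_left add_divide_distrib)
  have orth: "\<pi> x \<bullet> b = 0" for x
    using bb by (simp add: \<pi>_def inner_diff_left)
  have \<pi>V: "\<pi> x \<in> V" if "x \<in> V" for x
    unfolding \<pi>_def using that b(1) LV V(1) by (intro subspace_add subspace_scale) auto
  define V' where "V' = \<pi> ` V"
  have V'sub: "V' \<subseteq> V" using \<pi>V by (auto simp: V'_def)
  have bV': "b \<notin> V'" using orth bb unfolding V'_def by (metis imageE)
  have lat': "lattice_in V' (\<pi> ` L)"
    unfolding lattice_in_def
  proof (intro conjI)
    show "subspace V'" unfolding V'_def using lin V(1) by (rule linear_subspace_image)
    show "span (\<pi> ` L) = V'" unfolding V'_def using span_linear_image[OF lin, of L] V(2) by simp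
    show "0 \<in> \<pi> ` L" using L(1) linear_0[OF lin] by (metis image_eqI)
    show "\<forall>x\<in>\<pi> ` L. \<forall>y\<in>\<pi> ` L. x - y \<in> \<pi> ` L"
      using L(2) linear_diff[OF lin] by (auto simp flip: linear_diff[OF lin])
    have "s / 2 \<le> norm (\<pi> x)" if "x \<in> L" "\<pi> x \<noteq> 0" for x
      using norm_projection_ge[OF L s b(4) b(1) b(5) that(1), of "- (x \<bullet> b / (b \<bullet> b))"]
        orth[of x] that(2) unfolding \<pi>_def by simp
    then show "\<exists>r>0. \<forall>x\<in>\<pi> ` L. x \<noteq> 0 \<longrightarrow> r \<le> norm x"
      using s by (intro exI[of _ "s/2"]) auto
  qed
  have "dim V' < dim V"
  proof (rule dim_psubset)
    show "span V' \<subset> span V"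
    proof -
      have "span V' = V'" "span V = V" using lat' V(1) by (simp_all add: lattice_in_def span_eq_iff)
      then show ?thesis using V'sub bV' b(1) LV by blast
    qed
  qed
  show ?case
  proof (cases "V' = {0}")
    case False
    then obtain p where p: "p \<in> dual_in V' (\<pi> ` L)" "p \<noteq> 0"
      using less.hyps[OF \<open>dim V' < dim V\<close> lat'] by auto
    then have pb: "p \<bullet> b = 0" using orth by (auto simp: dual_in_def V'_def)
    have "p \<bullet> l \<in> \<int>" if "l \<in> L" for l
    proof -
      have "p \<bullet> l = p \<bullet> \<pi> l" by (simp add: \<pi>_def inner_diff_right pb)
      then show ?thesis using p(1) that by (auto simp: dual_in_def)
    qed
    then show ?thesis using p V'sub by (auto simp: dual_in_def)
  next
    case True
    have "(b /\<^sub>R (b \<bullet> b)) \<bullet> l \<in> \<int>" if l: "l \<in> L" for l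
    proof -
      define t where "t = l \<bullet> b / (b \<bullet> b)"
      have "\<pi> l = 0" using True l LV by (auto simp: V'_def)
      then have lt: "l = t *\<^sub>R b" by (simp add: \<pi>_def t_def)
      \<comment> \<open>Rounding the coefficient leaves a lattice vector of norm at most half of
        \<open>norm b\<close>, hence below the lower bound \<open>s\<close>; it must vanish, so
        \<open>t\<close> is an integer.\<close>
      define m where "m = l - of_int (round t) *\<^sub>R b"
      have mL: "m \<in> L" unfolding m_def using L int_scaleR_mem[OF L b(1)] l by blast
      have "m = (t - of_int (round t)) *\<^sub>R b" by (simp add: m_def lt algebra_simps)
      then have "norm m \<le> 1/2 * norm b"
        using mult_right_mono[OF of_int_round_abs_le[of t] norm_ge_zero[of b]] by (simp add: abs_minus_commute)
      then have "(norm m)\<^sup>2 \<le> (1/2 * norm b)\<^sup>2" by (intro power_mono) auto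
      also have "\<dots> = (norm b)\<^sup>2 / 4" by (simp add: power2_eq_square)
      also have "\<dots> \<le> s\<^sup>2 / 2" using b(5) by simp
      also have "\<dots> < s\<^sup>2" using s by simp
      finally have "norm m < s" using s by (simp add: power_less_imp_less_base)
      then have "m = 0" using b(4)[OF mL] by force
      then have "t *\<^sub>R b = of_int (round t) *\<^sub>R b" by (simp add: m_def lt)
      then have "t = of_int (round t)" using b(2) by (metis scaleR_cancel_right)
      then have "t \<in> \<int>" by (metis Ints_of_int)
      then show ?thesis by (simp add: t_def inner_commute field_simps)
    qed
    then show ?thesis
      using b LV V(1) by (intro bexI[of _ "b /\<^sub>R (b \<bullet> b)"]) (auto simp: dual_in_def intro: subspace_scale)
  qed
qed

lemma dual_in_pairing_nonzero:
  assumes "lattice_in V L" "p \<in> dual_in V L" "p \<noteq> 0"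
  shows "\<exists>b\<in>L. p \<bullet> b \<noteq> 0"
proof (rule ccontr)
  assume "\<not> ?thesis"
  then have "\<And>y. y \<in> L \<Longrightarrow> orthogonal p y" by (simp add: orthogonal_def)
  moreover have "p \<in> span L" using assms by (simp add: lattice_in_def dual_in_def)
  ultimately have "orthogonal p p" by (rule orthogonal_to_span[rotated])
  then show False using assms(3) by (simp add: orthogonal_def)
qed

text \<open>The point is that the section still spans. The map \<open>\<phi>\<close> kills the
  \<open>p\<close>-component with integer coefficients, so it sends \<open>L\<close> into the
  section, while on the hyperplane it is multiplication by the nonzero number
  \<open>p \<bullet> b\<close>.\<close>

lemma lattice_in_section:
  assumes lat: "lattice_in V L" and p: "p \<in> dual_in V L" "p \<noteq> 0"
  shows "lattice_in {x\<in>V. p \<bullet> x = 0} {x\<in>L. p \<bullet> x = 0}" (is "lattice_in ?V0 ?L0")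
    and "dim {x\<in>V. p \<bullet> x = 0} < dim V"
proof -
  have V: "subspace V" "span L = V" and L: "0 \<in> L" "\<And>x y. x \<in> L \<Longrightarrow> y \<in> L \<Longrightarrow> x - y \<in> L"
    using lat by (auto simp: lattice_in_def)
  have LV: "L \<subseteq> V" using V(2) span_superset by auto
  have V0: "subspace ?V0"
    using V(1) by (auto simp: subspace_def inner_add_right)
  have pV: "p \<in> V" using p by (auto simp: dual_in_def)
  obtain b where b: "b \<in> L" "p \<bullet> b \<noteq> 0"
    using dual_in_pairing_nonzero[OF assms] by auto
  define \<phi> where "\<phi> = (\<lambda>x. (p \<bullet> b) *\<^sub>R x - (p \<bullet> x) *\<^sub>R b)"
  have lin: "linear \<phi>"
    unfolding \<phi>_def by (rule linearI) (auto simp: algebra_simps inner_add_right)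
  have \<phi>L: "\<phi> l \<in> ?L0" if l: "l \<in> L" for l
  proof -
    have "p \<bullet> b \<in> \<int>" "p \<bullet> l \<in> \<int>" using p(1) l b(1) by (auto simp: dual_in_def)
    then obtain m n where "p \<bullet> b = of_int m" "p \<bullet> l = of_int n"
      by (metis Ints_cases)
    then have "\<phi> l \<in> L"
      unfolding \<phi>_def using L(2)[OF int_scaleR_mem[OF L l, of m] int_scaleR_mem[OF L b(1), of n]] by simp
    then show ?thesis by (simp add: \<phi>_def inner_diff_right)
  qed
  have "span ?L0 = ?V0"
  proof
    show "span ?L0 \<subseteq> ?V0" using LV V0 by (intro span_minimal) auto
    show "?V0 \<subseteq> span ?L0"
    proof
      fix x assume x: "x \<in> ?V0"
      then have "\<phi> x \<in> \<phi> ` span L" using V(2) by auto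
      also have "\<dots> = span (\<phi> ` L)" by (rule span_linear_image[OF lin, symmetric])
      also have "\<dots> \<subseteq> span ?L0" using \<phi>L by (intro span_mono) auto
      finally have "(p \<bullet> b) *\<^sub>R x \<in> span ?L0" using x by (simp add: \<phi>_def)
      then have "(1 / (p \<bullet> b)) *\<^sub>R ((p \<bullet> b) *\<^sub>R x) \<in> span ?L0" by (rule span_scale)
      then show "x \<in> span ?L0" using b(2) by simp
    qed
  qed
  moreover have "\<exists>r>0. \<forall>x\<in>L. x \<noteq> 0 \<longrightarrow> r \<le> norm x" using lat by (simp add: lattice_in_def)
  ultimately show "lattice_in ?V0 ?L0"
    unfolding lattice_in_def using V0 L by (auto simp: inner_diff_right)
  show "dim ?V0 < dim V"
  proof (rule dim_psubset)
    have "p \<notin> ?V0" using p(2) by simp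
    moreover have "span ?V0 = ?V0" "span V = V" using V0 V(1) by (simp_all only: span_eq_iff)
    ultimately show "span ?V0 \<subset> span V" using pV by blast
  qed
qed

lemma dual_in_diff: "lattice_in V L \<Longrightarrow> x \<in> dual_in V L \<Longrightarrow> y \<in> dual_in V L \<Longrightarrow> x - y \<in> dual_in V L"
  by (auto simp: dual_in_def lattice_in_def inner_diff_left intro: subspace_diff)

lemma dual_in_0: "lattice_in V L \<Longrightarrow> 0 \<in> dual_in V L"
  by (auto simp: dual_in_def lattice_in_def intro: subspace_0)

text \<open>The values of \<open>p\<close> on \<open>L\<close> are the multiples of their least
  positive element \<open>m\<close>. After division by \<open>m\<close>, the layers of
  \<open>L\<close> at consecutive integer heights are translates of the section by multiples of
  \<open>b\<close>.\<close>

lemma dual_in_primitive: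
  assumes lat: "lattice_in V L" and p: "p \<in> dual_in V L" "p \<noteq> 0"
  obtains m :: nat and b where "m \<ge> 1" "p /\<^sub>R of_nat m \<in> dual_in V L" "b \<in> L" "(p /\<^sub>R of_nat m) \<bullet> b = 1"
proof -
  have V: "subspace V" "span L = V" and L: "0 \<in> L" "\<And>x y. x \<in> L \<Longrightarrow> y \<in> L \<Longrightarrow> x - y \<in> L"
    using lat by (auto simp: lattice_in_def)
  have pV: "p \<in> V" using p by (auto simp: dual_in_def)
  obtain b0 where b0: "b0 \<in> L" "p \<bullet> b0 \<noteq> 0"
    using dual_in_pairing_nonzero[OF assms] by auto
  define P where "P = (\<lambda>m::nat. m \<ge> 1 \<and> (\<exists>b\<in>L. p \<bullet> b = of_nat m))"
  have "\<exists>m. P m"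
  proof -
    obtain n where n: "p \<bullet> b0 = of_int n" using p(1) b0(1) by (auto simp: dual_in_def elim!: Ints_cases)
    have "of_int (sgn n) *\<^sub>R b0 \<in> L" by (rule int_scaleR_mem[OF L b0(1)])
    moreover have "p \<bullet> (of_int (sgn n) *\<^sub>R b0) = of_nat (nat \<bar>n\<bar>)"
      using n by (simp add: abs_sgn) (simp add: mult.commute sgn_if)
    moreover have "nat \<bar>n\<bar> \<ge> 1" using n b0(2) by auto
    ultimately show ?thesis unfolding P_def by blast
  qed
  define m where "m = (LEAST m. P m)"
  have P: "P m" unfolding m_def using \<open>\<exists>m. P m\<close> by (rule LeastI_ex)
  obtain b where b: "m \<ge> 1" "b \<in> L" "p \<bullet> b = of_nat m" using P unfolding P_def by auto
  have "(p /\<^sub>R of_nat m) \<bullet> l \<in> \<int>" if l: "l \<in> L" for l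
  proof -
    obtain n where n: "p \<bullet> l = of_int n" using p(1) l by (auto simp: dual_in_def elim!: Ints_cases)
    \<comment> \<open>Division with remainder: \<open>l'\<close> has height \<open>n mod m\<close>,
      smaller than the least positive height, hence 0.\<close>
    define l' where "l' = l - of_int (n div int m) *\<^sub>R b"
    have l': "l' \<in> L" unfolding l'_def using L int_scaleR_mem[OF L b(2)] l by blast
    have "p \<bullet> l' = of_int (n - (n div int m) * int m)"
      by (simp add: l'_def inner_diff_right n b(3))
    also have "n - (n div int m) * int m = n mod int m" by (simp add: minus_div_mult_eq_mod)
    also have "real_of_int (n mod int m) = of_nat (nat (n mod int m))" using b(1) by simp
    finally have eq: "p \<bullet> l' = of_nat (nat (n mod int m))" .
    have "nat (n mod int m) < m" using b(1) by (simp add: nat_less_iff)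
    then have "\<not> P (nat (n mod int m))" unfolding m_def by (rule not_less_Least)
    then have "nat (n mod int m) = 0" using eq l' by (auto simp: P_def)
    then have "n mod int m = 0" using b(1) by (simp add: order_antisym)
    then obtain k where "n = int m * k" by auto
    then have "(p /\<^sub>R of_nat m) \<bullet> l = of_int k" using n b(1) by simp
    then show ?thesis by simp
  qed
  moreover have "p /\<^sub>R of_nat m \<in> V" using pV V(1) by (rule subspace_scale[rotated])
  ultimately show thesis
    using that[of m b] b by (auto simp: dual_in_def)
qed

text \<open>The corrected functional vanishes at \<open>b\<close>, and every lattice vector is an
  integer multiple of \<open>b\<close> plus an element of the section, where \<open>q\<close> is
  integral. The correction is along \<open>p\<close>, so \<open>q\<close> is the orthogonal
  projection of its lift.\<close>

lemma dual_in_section_lift: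
  assumes lat: "lattice_in V L" and p: "p \<in> dual_in V L" and b: "b \<in> L" "p \<bullet> b = 1"
    and q: "q \<in> dual_in {x\<in>V. p \<bullet> x = 0} {x\<in>L. p \<bullet> x = 0}"
  shows "q - (q \<bullet> b) *\<^sub>R p \<in> dual_in V L"
proof -
  have V: "subspace V" and L: "0 \<in> L" "\<And>x y. x \<in> L \<Longrightarrow> y \<in> L \<Longrightarrow> x - y \<in> L"
    using lat by (auto simp: lattice_in_def)
  have "(q - (q \<bullet> b) *\<^sub>R p) \<bullet> l \<in> \<int>" if l: "l \<in> L" for l
  proof -
    obtain n where n: "p \<bullet> l = of_int n" using p l by (auto simp: dual_in_def elim!: Ints_cases)
    have "l - of_int n *\<^sub>R b \<in> L" using L int_scaleR_mem[OF L b(1)] l by blast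
    moreover have "p \<bullet> (l - of_int n *\<^sub>R b) = 0" by (simp add: inner_diff_right n b(2))
    ultimately have "q \<bullet> (l - of_int n *\<^sub>R b) \<in> \<int>" using q by (auto simp: dual_in_def)
    then show ?thesis by (simp add: inner_diff_right inner_diff_left n mult.commute)
  qed
  then show ?thesis
    using q p V by (auto simp: dual_in_def intro!: subspace_diff subspace_scale)
qed

section \<open>Transference, and covering by a thickened segment\<close>

text \<open>Slice by a primitive, near-shortest dual vector \<open>p\<close>. Layers are
  \<open>1 / norm p\<close> apart, so some layer is within \<open>1 / (2 * s)\<close> of
  \<open>x\<close>. Dual vectors of the section are projections of lifts, hence of norm at least
  \<open>s / 2\<close> by \<open>norm_projection_ge\<close>, and the induction hypothesis applies
  inside the layer.\<close>

lemma transference: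
  fixes V L :: "'a::euclidean_space set"
  assumes "lattice_in V L" "r > 0" "\<And>q. q \<in> dual_in V L \<Longrightarrow> q \<noteq> 0 \<Longrightarrow> r \<le> norm q" "x \<in> V"
  shows "\<exists>l\<in>L. norm (x - l) \<le> 3 ^ dim V / r"
  using assms
proof (induction "dim V" arbitrary: V L r x rule: less_induct)
  case less
  note lat = less.prems(1)
  have V: "subspace V" "span L = V" and L: "0 \<in> L" "\<And>x y. x \<in> L \<Longrightarrow> y \<in> L \<Longrightarrow> x - y \<in> L"
    using lat by (auto simp: lattice_in_def)
  have LV: "L \<subseteq> V" using V(2) span_superset by auto
  show ?case
  proof (cases "V = {0}")
    case True
    then show ?thesis using less.prems L by (intro bexI[of _ 0]) auto
  next
    case False
    obtain p0 where "p0 \<in> dual_in V L" "p0 \<noteq> 0" using dual_in_nontrivial[OF lat False] by auto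
    then obtain p1 s where p1: "p1 \<in> dual_in V L" "p1 \<noteq> 0" "r \<le> s"
      "\<And>x. x \<in> dual_in V L \<Longrightarrow> x \<noteq> 0 \<Longrightarrow> s \<le> norm x" "(norm p1)\<^sup>2 \<le> 2 * s\<^sup>2"
      using obtain_near_shortest[of p0 "dual_in V L" r] less.prems by metis
    have s: "s > 0" using p1 less.prems by simp
    obtain m :: nat and b where m: "m \<ge> 1" "p1 /\<^sub>R of_nat m \<in> dual_in V L" "b \<in> L" "(p1 /\<^sub>R of_nat m) \<bullet> b = 1"
      using dual_in_primitive[OF lat p1(1,2)] by metis
    define p where "p = p1 /\<^sub>R of_nat m"
    have p: "p \<in> dual_in V L" "p \<noteq> 0" "p \<bullet> b = 1" using m p1 by (auto simp: p_def)
    have "norm p \<le> norm p1" using m(1) mult_right_mono[of 1 "real m" "norm p1"] by (simp add: p_def field_simps)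
    then have "(norm p)\<^sup>2 \<le> 2 * s\<^sup>2" using p1(5) power_mono[of "norm p" "norm p1" 2] norm_ge_zero[of p] by linarith
    have sp: "s \<le> norm p" using p1(4) p by auto
    define V0 where "V0 = {x\<in>V. p \<bullet> x = 0}"
    define L0 where "L0 = {x\<in>L. p \<bullet> x = 0}"
    note sec = lattice_in_section[OF lat p(1,2), folded V0_def L0_def]
    have dual0: "s / 2 \<le> norm q" if q: "q \<in> dual_in V0 L0" "q \<noteq> 0" for q
    proof -
      have "q - (q \<bullet> b) *\<^sub>R p \<in> dual_in V L"
        using dual_in_section_lift[OF lat p(1) m(3) p(3)] q by (simp add: V0_def L0_def)
      from norm_projection_ge[OF dual_in_0[OF lat] dual_in_diff[OF lat] s p1(4) p(1) _ this, of "q \<bullet> b"]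
      show ?thesis using q \<open>(norm p)\<^sup>2 \<le> 2 * s\<^sup>2\<close> by (simp add: dual_in_def V0_def inner_commute)
    qed
    define n where "n = round (p \<bullet> x)"
    define y where "y = x - of_int n *\<^sub>R b"
    have yV: "y \<in> V" unfolding y_def using LV m(3) V(1) less.prems(4) by (auto intro!: subspace_diff subspace_scale)
    have py: "\<bar>p \<bullet> y\<bar> \<le> 1/2"
      using of_int_round_abs_le[of "p \<bullet> x"] by (simp add: y_def inner_diff_right p(3) n_def abs_minus_commute)
    define z where "z = y - ((p \<bullet> y) / (p \<bullet> p)) *\<^sub>R p"
    have "z \<in> V0"
      using yV p V(1) by (auto simp: z_def V0_def dual_in_def inner_diff_right intro!: subspace_diff subspace_scale)
    then obtain l where l: "l \<in> L0" "norm (z - l) \<le> 3 ^ dim V0 / (s/2)"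
      using less.hyps[OF sec(2) sec(1) _ dual0, of z] s by auto
    have "norm (y - z) = \<bar>p \<bullet> y\<bar> / norm p"
      using p(2) by (simp add: z_def power2_norm_eq_inner[symmetric] power2_eq_square)
    also have "\<dots> \<le> (1/2) / s" using py sp s by (intro frac_le) auto
    finally have yz: "norm (y - z) \<le> (1/2) / s" .
    have "norm (y - l) \<le> norm (y - z) + norm (z - l)" using norm_triangle_ineq[of "y - z" "z - l"] by simp
    also have "\<dots> \<le> (1/2) / s + 3 ^ dim V0 / (s/2)" using yz l(2) by linarith
    also have "\<dots> = (1/2 + 2 * 3 ^ dim V0) / s" using s by (simp add: field_simps)
    \<comment> \<open>This recursion, 1/2 for reaching the layer plus a doubling for the halved dual
      minimum, is the source of the base 3.\<close>
    also have "\<dots> \<le> 3 ^ Suc (dim V0) / s"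
    proof (intro divide_right_mono)
      show "1/2 + 2 * 3 ^ dim V0 \<le> (3::real) ^ Suc (dim V0)"
        unfolding power_Suc using one_le_power[of "3::real" "dim V0"] by linarith
    qed (use s in simp)
    also have "\<dots> \<le> 3 ^ dim V / s"
      using s sec(2) by (intro divide_right_mono power_increasing) auto
    also have "\<dots> \<le> 3 ^ dim V / r" using p1(3) less.prems(2) by (intro divide_left_mono) auto
    finally have "norm (x - (of_int n *\<^sub>R b + l)) \<le> 3 ^ dim V / r"
      by (simp add: y_def algebra_simps)
    moreover have "of_int n *\<^sub>R b - (0 - l) \<in> L"
      using L l int_scaleR_mem[OF L m(3)] unfolding L0_def by blast
    ultimately show ?thesis by (intro bexI[of _ "of_int n *\<^sub>R b + l"]) auto
  qed
qed


text \<open>The self-adjoint map \<open>B\<close> in the proof sends the unit ball into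
  \<open>[-v/2, v/2] + B\<^sub>\<delta>\<close>, and transference is applied to the preimage lattice, whose dual is the
  image of the dual lattice under \<open>B\<close>.\<close>

lemma segment_ball_cover:
  fixes V L :: "'a::euclidean_space set"
  assumes lat: "lattice_in V L" and vV: "v \<in> V" and \<delta>: "\<delta> > 0" and c: "3 ^ dim V \<le> c"
    and cond: "\<And>q. q \<in> dual_in V L \<Longrightarrow> q \<noteq> 0 \<Longrightarrow> c \<le> \<delta> * norm q \<or> 2 * c \<le> \<bar>q \<bullet> v\<bar>"
    and xV: "x \<in> V"
  shows "\<exists>s\<in>{0..1}. \<exists>l\<in>L. norm (x - s *\<^sub>R v - l) \<le> \<delta>"
proof -
  have V: "subspace V" "span L = V" and L: "0 \<in> L" "\<And>x y. x \<in> L \<Longrightarrow> y \<in> L \<Longrightarrow> x - y \<in> L"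
    using lat by (auto simp: lattice_in_def)
  obtain r where r: "r > 0" "\<And>x. x \<in> L \<Longrightarrow> x \<noteq> 0 \<Longrightarrow> r \<le> norm x"
    using lat by (auto simp: lattice_in_def)
  have LV: "L \<subseteq> V" using V(2) span_superset by auto
  define h where "h = norm v / 2"
  \<comment> \<open>With this choice \<open>B\<close> multiplies by \<open>\<delta>\<close>
    orthogonally to \<open>v\<close> and by \<open>\<delta> + h\<close> along \<open>v\<close>. If
    \<open>v = 0\<close>, division by zero makes \<open>\<beta>\<close> zero and \<open>B\<close> a
    plain scaling.\<close>
  define \<beta> where "\<beta> = 1 / (2 * norm v)"
  have h: "h \<ge> 0" and \<beta>: "\<beta> \<ge> 0" by (auto simp: h_def \<beta>_def)
  have \<beta>v: "\<beta> * (v \<bullet> v) = h"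
    by (cases "v = 0") (auto simp: \<beta>_def h_def power2_norm_eq_inner[symmetric] power2_eq_square)
  define B where "B = (\<lambda>y. \<delta> *\<^sub>R y + (\<beta> * (y \<bullet> v)) *\<^sub>R v)"
  have lin: "linear B"
    unfolding B_def by (rule linearI) (auto simp: algebra_simps inner_add_left)
  have sym: "B y \<bullet> z = y \<bullet> B z" for y z
    by (simp add: B_def inner_add_left inner_add_right inner_commute)
  have Bv: "B y \<bullet> v = (\<delta> + h) * (y \<bullet> v)" for y
    using \<beta>v by (simp add: B_def inner_add_left algebra_simps)
  have BV: "B y \<in> V" if "y \<in> V" for y
    unfolding B_def using that vV V(1) by (auto intro!: subspace_add subspace_scale)
  have Bsurj: "\<exists>z\<in>V. y = B z" if "y \<in> V" for y
  proof -
    define z where "z = (1/\<delta>) *\<^sub>R (y - (\<beta> * (y \<bullet> v) / (\<delta> + h)) *\<^sub>R v)"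
    have "z \<in> V" unfolding z_def using that vV V(1) by (auto intro!: subspace_diff subspace_scale)
    have "z \<bullet> v = (1/\<delta>) * (y \<bullet> v - (y \<bullet> v) * (\<beta> * (v \<bullet> v)) / (\<delta> + h))"
      by (simp add: z_def inner_diff_left)
    also have "\<dots> = (y \<bullet> v) / (\<delta> + h)" unfolding \<beta>v using \<delta> h by (simp add: field_simps)
    finally have "B z = y" using \<delta> by (simp add: B_def) (simp add: z_def)
    then show ?thesis using \<open>z \<in> V\<close> by auto
  qed
  have Bge: "\<delta> * norm y \<le> norm (B y)" for y
  proof (cases "y = 0")
    case False
    have "norm y * (\<delta> * norm y) \<le> \<delta> * (y \<bullet> y) + \<beta> * (y \<bullet> v)\<^sup>2"
      using \<beta> by (simp add: power2_norm_eq_inner[symmetric] power2_eq_square)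
    also have "\<dots> = y \<bullet> B y" by (simp add: B_def inner_add_right power2_eq_square)
    also have "\<dots> \<le> norm y * norm (B y)" by (rule norm_cauchy_schwarz)
    finally show ?thesis using False by simp
  qed simp
  have Bgev: "\<bar>y \<bullet> v\<bar> / 2 \<le> norm (B y)" for y
  proof (cases "v = 0")
    case False
    have "norm v * (\<bar>y \<bullet> v\<bar> / 2) = h * \<bar>y \<bullet> v\<bar>" by (simp add: h_def)
    also have "\<dots> \<le> \<bar>B y \<bullet> v\<bar>" unfolding Bv using \<delta> h by (simp add: abs_mult mult_right_mono)
    also have "\<dots> \<le> norm v * norm (B y)" using Cauchy_Schwarz_ineq2[of "B y" v] by (simp add: mult.commute)
    finally show ?thesis using False by simp
  qed simp
  have Ble: "norm (B y) \<le> (\<delta> + h) * norm y" for y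
  proof -
    have "norm (B y) \<le> norm (\<delta> *\<^sub>R y) + norm ((\<beta> * (y \<bullet> v)) *\<^sub>R v)" unfolding B_def by (rule norm_triangle_ineq)
    also have "\<dots> = \<delta> * norm y + \<beta> * \<bar>y \<bullet> v\<bar> * norm v" using \<delta> \<beta> by (simp add: abs_mult)
    also have "\<dots> \<le> \<delta> * norm y + \<beta> * (norm y * norm v) * norm v"
      using \<beta> Cauchy_Schwarz_ineq2[of y v] by (intro add_mono mult_right_mono mult_left_mono) auto
    also have "\<dots> = \<delta> * norm y + (\<beta> * (v \<bullet> v)) * norm y"
      by (simp add: power2_norm_eq_inner[symmetric] power2_eq_square)
    finally show ?thesis unfolding \<beta>v by (simp add: algebra_simps)
  qed
  have B0: "y = 0" if "B y = 0" for y
    using Bge[of y] that \<delta> by (simp add: mult_le_0_iff)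
  have Binj: "y = z" if "B y = B z" for y z
    using B0[of "y - z"] that linear_diff[OF lin] by simp
  define L' where "L' = {y\<in>V. B y \<in> L}"
  have BL': "B ` L' = L" using Bsurj LV unfolding L'_def by blast
  have lat': "lattice_in V L'"
    unfolding lattice_in_def
  proof (intro conjI)
    show "subspace V" by fact
    show "0 \<in> L'" using L V(1) linear_0[OF lin] by (simp add: L'_def subspace_0)
    show "\<forall>x\<in>L'. \<forall>y\<in>L'. x - y \<in> L'"
      using L V(1) linear_diff[OF lin] by (simp add: L'_def subspace_diff)
    have "r / (\<delta> + h) \<le> norm y" if "y \<in> L'" "y \<noteq> 0" for y
    proof -
      have "r \<le> norm (B y)" using that B0 r(2) by (auto simp: L'_def)
      then have "r \<le> (\<delta> + h) * norm y" using Ble[of y] by linarith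
      then show ?thesis using \<delta> h by (simp add: field_simps)
    qed
    then show "\<exists>r>0. \<forall>x\<in>L'. x \<noteq> 0 \<longrightarrow> r \<le> norm x"
      using r(1) \<delta> h by (intro exI[of _ "r / (\<delta> + h)"]) auto
    show "span L' = V"
    proof
      show "span L' \<subseteq> V" using V(1) by (intro span_minimal) (auto simp: L'_def)
      show "V \<subseteq> span L'"
      proof
        fix y assume "y \<in> V"
        then have "B y \<in> span (B ` L')" using BV BL' V(2) by simp
        then have "B y \<in> B ` span L'" using span_linear_image[OF lin] by simp
        then show "y \<in> span L'" using Binj by blast
      qed
    qed
  qed
  \<comment> \<open>The two alternatives in \<open>cond\<close> match the two lower bounds for
    \<open>B\<close>: \<open>Bge\<close> handles long dual vectors and \<open>Bgev\<close> those
    with a large value at \<open>v\<close>; the factor 2 in \<open>2 * c\<close> absorbs the half in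
    \<open>Bgev\<close>.\<close>
  have dual': "c \<le> norm q" if q: "q \<in> dual_in V L'" "q \<noteq> 0" for q
  proof -
    obtain p where p: "p \<in> V" "q = B p" using q Bsurj by (auto simp: dual_in_def)
    have "p \<bullet> l \<in> \<int>" if "l \<in> L" for l
    proof -
      obtain y where "y \<in> L'" "l = B y" using \<open>l \<in> L\<close> BL' by auto
      then show ?thesis using q(1) p(2) sym[of p y] by (auto simp: dual_in_def)
    qed
    then have "p \<in> dual_in V L" using p by (auto simp: dual_in_def)
    moreover have "p \<noteq> 0" using p q linear_0[OF lin] by auto
    ultimately show ?thesis using cond[of p] Bge[of p] Bgev[of p] p(2) by fastforce
  qed
  have c0: "c > 0" using c zero_less_power[of "3::real" "dim V"] by linarith
  \<comment> \<open>The image of the unit ball is symmetric about 0, so the segment from 0 to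
    \<open>v\<close> is recentred at its midpoint.\<close>
  have "x - (1/2) *\<^sub>R v \<in> V" using xV vV V(1) by (auto intro!: subspace_diff subspace_scale)
  then obtain y where y: "y \<in> V" "x - (1/2) *\<^sub>R v = B y" using Bsurj by blast
  obtain l where l: "l \<in> L'" "norm (y - l) \<le> 3 ^ dim V / c"
    using transference[OF lat' c0 dual' y(1)] by auto
  define u where "u = y - l"
  have u: "norm u \<le> 1" using l(2) c c0 unfolding u_def by (smt (verit) divide_le_eq_1_pos)
  have "B u = x - (1/2) *\<^sub>R v - B l" using y(2) by (simp add: u_def linear_diff[OF lin])
  then have eq: "x - (1/2 + \<beta> * (u \<bullet> v)) *\<^sub>R v - B l = \<delta> *\<^sub>R u" by (simp add: B_def algebra_simps)
  have "\<bar>u \<bullet> v\<bar> \<le> 1 * norm v"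
    using Cauchy_Schwarz_ineq2[of u v] mult_right_mono[OF u norm_ge_zero[of v]] by linarith
  then have "\<bar>\<beta> * (u \<bullet> v)\<bar> \<le> \<beta> * norm v" using \<beta> by (simp add: abs_mult mult_left_mono)
  also have "\<dots> \<le> 1/2" by (cases "v = 0") (auto simp: \<beta>_def)
  finally have "1/2 + \<beta> * (u \<bullet> v) \<in> {0..1}" unfolding atLeastAtMost_iff by linarith
  moreover have "norm (\<delta> *\<^sub>R u) \<le> \<delta>" using u \<delta> by simp
  moreover have "B l \<in> L" using l(1) by (simp add: L'_def)
  ultimately show ?thesis using eq by metis
qed

section \<open>Lowering the required bound on dual vectors to 1\<close>

text \<open>The size of \<open>R\<close> is dictated by lifting: if
  \<open>norm q < 2 * c / \<delta>\<close> and the coefficient \<open>A\<close> is at most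
  \<open>4 * c / (\<delta> * norm p) + 4 * c\<close> in absolute value, then the lift of
  \<open>q\<close> whose value at \<open>v\<close> is nearest 0 has norm at most \<open>R\<close>
  and value below 1, against \<open>cond\<close>. So \<open>A\<close> is large, and the motion
  inside a layer is fast enough for \<open>segment_ball_cover\<close>.\<close>

lemma segment_ball_cover_step:
  fixes L :: "'a::euclidean_space set"
  assumes lat: "lattice_in UNIV L" and p: "p \<in> dual_in UNIV L" and b: "b \<in> L" "p \<bullet> b = 1"
    and pv: "1 \<le> p \<bullet> v" "p \<bullet> v < 2" and \<delta>: "\<delta> > 0" and c: "3 ^ DIM('a) \<le> c"
    and R: "6 * c / \<delta> + (1 + 4 * c) * norm p \<le> R"
    and cond: "\<And>q. q \<in> dual_in UNIV L \<Longrightarrow> q \<noteq> 0 \<Longrightarrow> norm q \<le> R \<Longrightarrow> 1 \<le> \<bar>q \<bullet> v\<bar>"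
  shows "\<exists>s\<in>{0..1}. \<exists>l\<in>L. norm (x - s *\<^sub>R v - l) \<le> \<delta>"
proof -
  have L: "0 \<in> L" "\<And>x y. x \<in> L \<Longrightarrow> y \<in> L \<Longrightarrow> x - y \<in> L"
    using lat by (auto simp: lattice_in_def)
  have p0: "p \<noteq> 0" using b(2) by auto
  have c0: "c > 0" using c zero_less_power[of "3::real" "DIM('a)"] by linarith
  define V0 where "V0 = {x\<in>UNIV. p \<bullet> x = 0}"
  define L0 where "L0 = {x\<in>L. p \<bullet> x = 0}"
  note sec = lattice_in_section[OF lat p p0, folded V0_def L0_def]
  have "3 ^ dim V0 \<le> (3::real) ^ DIM('a)"
    using sec(2) by (intro power_increasing) auto
  then have c': "3 ^ dim V0 \<le> c" using c by linarith
  define h where "h = p \<bullet> v"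
  have h: "1 \<le> h" "h < 2" using pv by (auto simp: h_def)
  \<comment> \<open>While \<open>p \<bullet> (s v)\<close> sweeps a window of length \<open>\<eta>\<close>, the flow stays within \<open>\<delta>/2\<close> of
    one layer of constant \<open>p\<close>-value; its motion inside the layer is the segment \<open>v'\<close>.\<close>
  define \<eta> where "\<eta> = min (1/2) (\<delta> * norm p / 2)"
  have \<eta>: "0 < \<eta>" "\<eta> \<le> 1/2" "\<eta> / norm p \<le> \<delta> / 2" using \<delta> p0 by (auto simp: \<eta>_def field_simps)
  \<comment> \<open>Translating by a multiple of \<open>b\<close> brings the height into [0,1),
    which the flow sweeps within unit time because \<open>h\<close> is at least 1.\<close>
  define y where "y = x - of_int \<lfloor>p \<bullet> x\<rfloor> *\<^sub>R b"
  define t where "t = p \<bullet> y"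
  have t: "0 \<le> t" "t < 1" unfolding t_def y_def inner_diff_right inner_scaleR_right b(2)
    by linarith+
  \<comment> \<open>The time window of length \<open>\<eta> / h\<close> from \<open>s1\<close>
    contains the moment when the flow reaches height \<open>t\<close>. The truncation at 0 keeps it
    inside [0,1] when \<open>t < \<eta>\<close>.\<close>
  define s1 where "s1 = max 0 ((t - \<eta>) / h)"
  have s1: "0 \<le> s1" "s1 * h \<le> t" "t \<le> s1 * h + \<eta>" "s1 + \<eta> / h \<le> 1"
    using t \<eta> h by (auto simp: s1_def max_def field_simps)
  define u where "u = y - s1 *\<^sub>R v"
  have pu: "p \<bullet> u = t - s1 * h" by (simp add: u_def inner_diff_right t_def h_def)
  define v' where "v' = (\<eta> / h) *\<^sub>R (v - (h / (p \<bullet> p)) *\<^sub>R p)"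
  define z where "z = u - ((p \<bullet> u) / (p \<bullet> p)) *\<^sub>R p"
  have v'0: "v' \<in> V0" using p0 by (simp add: v'_def V0_def inner_diff_right h_def)
  have z0: "z \<in> V0" using p0 by (simp add: z_def V0_def inner_diff_right)
  \<comment> \<open>Only radius \<open>\<delta> / 2\<close> is spent inside the layer; the other
    half pays for the displacement along \<open>p\<close>.\<close>
  have cond0: "c \<le> \<delta> / 2 * norm q \<or> 2 * c \<le> \<bar>q \<bullet> v'\<bar>" if q: "q \<in> dual_in V0 L0" "q \<noteq> 0" for q
  proof (rule disjCI)
    assume "\<not> 2 * c \<le> \<bar>q \<bullet> v'\<bar>"
    show "c \<le> \<delta> / 2 * norm q"
    proof (rule ccontr)
      assume "\<not> c \<le> \<delta> / 2 * norm q"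
      then have nq: "norm q < 2 * c / \<delta>" using \<delta> by (simp add: field_simps)
      have qp: "q \<bullet> p = 0" using q by (simp add: dual_in_def V0_def inner_commute)
      have lift: "q - (q \<bullet> b) *\<^sub>R p \<in> dual_in UNIV L"
        using dual_in_section_lift[OF lat p b] q by (simp add: V0_def L0_def)
      define A where "A = q \<bullet> v / h"
      \<comment> \<open>The lifts of \<open>q\<close> are \<open>q + m p\<close> with
        \<open>m\<close> in a coset of the integers; this rounding picks the \<open>m\<close>
        closest to \<open>-A\<close>, making the value at \<open>v\<close> at most
        \<open>h / 2\<close>.\<close>
      define k where "k = round (q \<bullet> b - A)"
      define m where "m = of_int k - q \<bullet> b"
      have m: "\<bar>m + A\<bar> \<le> 1/2"
        using of_int_round_abs_le[of "q \<bullet> b - A"] by (simp add: m_def k_def algebra_simps)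
      define q' where "q' = q + m *\<^sub>R p"
      have "q' = (q - (q \<bullet> b) *\<^sub>R p) - of_int (- k) *\<^sub>R p"
        by (simp add: q'_def m_def algebra_simps)
      then have q'D: "q' \<in> dual_in UNIV L"
        using dual_in_diff[OF lat lift int_scaleR_mem[OF dual_in_0[OF lat] dual_in_diff[OF lat] p, of "- k"]] by simp
      have "q \<bullet> q' = q \<bullet> q" by (simp add: q'_def inner_add_right qp)
      then have q'0: "q' \<noteq> 0" using q(2) by auto
      have "q' \<bullet> v = (m + A) * h"
        using h by (simp add: q'_def inner_add_left A_def h_def[symmetric] algebra_simps)
      then have "\<bar>q' \<bullet> v\<bar> \<le> 1/2 * h" using m h by (simp add: abs_mult mult_right_mono)
      then have "\<bar>q' \<bullet> v\<bar> < 1" using h by linarith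
      then have "R < norm q'" using cond[OF q'D q'0] by linarith
      also have "\<dots> \<le> norm q + \<bar>m\<bar> * norm p"
        unfolding q'_def using norm_triangle_ineq[of q "m *\<^sub>R p"] by simp
      also have "\<dots> \<le> norm q + (\<bar>A\<bar> + 1) * norm p"
        using m by (intro add_left_mono mult_right_mono norm_ge_zero) linarith
      finally have "R < norm q + (\<bar>A\<bar> + 1) * norm p" .
      moreover define K where "K = c / \<delta>"
      moreover have "6 * K + norm p + 4 * (c * norm p) \<le> R"
        using R by (simp add: K_def algebra_simps)
      moreover have "norm q < 2 * K" using nq by (simp add: K_def)
      ultimately have "4 * K + 4 * (c * norm p) < \<bar>A\<bar> * norm p"
        unfolding distrib_right by linarith
      then have A: "4 * c / (\<delta> * norm p) + 4 * c < \<bar>A\<bar>"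
        using p0 \<delta> by (simp add: K_def field_simps)
      \<comment> \<open>Each summand serves one branch of the minimum defining
        \<open>\<eta>\<close>: \<open>4 * c\<close> for 1/2, the quotient for
        \<open>\<delta> * norm p / 2\<close>.\<close>
      have "2 * c \<le> \<eta> * (4 * c / (\<delta> * norm p) + 4 * c)"
      proof (cases "\<eta> = 1/2")
        case True
        have "0 \<le> 4 * c / (\<delta> * norm p)" using \<delta> c0 by simp
        then show ?thesis unfolding True by simp
      next
        case False
        then have "\<eta> = \<delta> * norm p / 2" by (auto simp: \<eta>_def min_def split: if_splits)
        then have "2 * c = \<eta> * (4 * c / (\<delta> * norm p))" using \<delta> p0 by (simp add: field_simps)
        then show ?thesis using \<eta>(1) c0 by (simp add: distrib_left)
      qed
      also have "\<dots> \<le> \<eta> * \<bar>A\<bar>" using A \<eta> by (intro mult_left_mono) auto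
      also have "\<dots> = \<bar>q \<bullet> v'\<bar>"
        using \<eta>(1) h qp by (simp add: v'_def A_def inner_diff_right abs_mult)
      finally show False using \<open>\<not> 2 * c \<le> \<bar>q \<bullet> v'\<bar>\<close> by simp
    qed
  qed
  obtain \<tau> l where \<tau>: "\<tau> \<in> {0..1}" "l \<in> L0" "norm (z - \<tau> *\<^sub>R v' - l) \<le> \<delta> / 2"
    using segment_ball_cover[OF sec(1) v'0 _ c' cond0 z0] \<delta> by auto
  define s where "s = s1 + \<tau> * (\<eta> / h)"
  \<comment> \<open>Height mismatch between target and flow: \<open>p \<bullet> u\<close> and
    \<open>\<tau> * \<eta>\<close> both lie between 0 and \<open>\<eta>\<close>, so correcting along
    \<open>p\<close> costs at most \<open>\<delta> / 2\<close>.\<close>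
  define \<epsilon> where "\<epsilon> = (p \<bullet> u - \<tau> * \<eta>) / (p \<bullet> p)"
  have "\<tau> * (\<eta> / h) \<le> 1 * (\<eta> / h)" "0 \<le> \<tau> * (\<eta> / h)" using \<tau>(1) \<eta> h by (auto intro!: mult_right_mono divide_right_mono)
  then have s: "s \<in> {0..1}" using s1 by (auto simp: s_def)
  have "0 \<le> \<tau> * \<eta>" "\<tau> * \<eta> \<le> 1 * \<eta>" using \<tau>(1) \<eta> by (auto intro!: mult_right_mono)
  then have "\<bar>p \<bullet> u - \<tau> * \<eta>\<bar> \<le> \<eta>" unfolding pu using s1 by linarith
  then have "\<bar>p \<bullet> u - \<tau> * \<eta>\<bar> / norm p \<le> \<eta> / norm p" by (intro divide_right_mono) auto
  moreover have "norm (\<epsilon> *\<^sub>R p) = \<bar>p \<bullet> u - \<tau> * \<eta>\<bar> / norm p"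
    using p0 by (simp add: \<epsilon>_def power2_norm_eq_inner[symmetric] power2_eq_square)
  ultimately have e: "norm (\<epsilon> *\<^sub>R p) \<le> \<delta> / 2" using \<eta>(3) by linarith
  have eq: "y - s *\<^sub>R v - l = (z - \<tau> *\<^sub>R v' - l) + \<epsilon> *\<^sub>R p"
    using h by (simp add: z_def v'_def \<epsilon>_def u_def s_def algebra_simps diff_divide_distrib add_divide_distrib)
  have "norm (y - s *\<^sub>R v - l) \<le> \<delta> / 2 + \<delta> / 2"
    unfolding eq using \<tau>(3) e by (rule norm_triangle_mono)
  then have "norm (y - s *\<^sub>R v - l) \<le> \<delta>" by simp
  moreover have "y - s *\<^sub>R v - l = x - s *\<^sub>R v - (of_int \<lfloor>p \<bullet> x\<rfloor> *\<^sub>R b - (0 - l))"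
    by (simp add: y_def algebra_simps)
  moreover have "of_int \<lfloor>p \<bullet> x\<rfloor> *\<^sub>R b - (0 - l) \<in> L"
    using L \<tau>(2) int_scaleR_mem[OF L b(1)] unfolding L0_def by blast
  ultimately show ?thesis using s by metis
qed


text \<open>\<open>H i\<close> demands the bound \<open>2 ^ (N - i)\<close> on radius
  \<open>a i / \<delta>\<close>; \<open>H N\<close> is the hypothesis. If \<open>H 0\<close> holds,
  \<open>2 ^ N\<close> exceeds the \<open>2 * c\<close> needed by \<open>segment_ball_cover\<close>.
  Otherwise \<open>H (Suc i)\<close> holds and \<open>H i\<close> fails for some \<open>i\<close>,
  and rescaling \<open>v\<close> puts \<open>segment_ball_cover_step\<close> in force. The ratio
  \<open>11 * c\<close> of radii comes from \<open>6 * c + (1 + 4 * c) * a i\<close>, as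
  \<open>c\<close> and \<open>a i\<close> are at least 1.\<close>

lemma segment_ball_cover_dual_ball:
  fixes L :: "'a::euclidean_space set"
  assumes lat: "lattice_in UNIV L" and \<delta>: "\<delta> > 0" and c: "c = 3 ^ DIM('a)"
    and N: "2 * c \<le> 2 ^ N"
    and cond: "\<And>q. q \<in> dual_in UNIV L \<Longrightarrow> q \<noteq> 0 \<Longrightarrow> norm q \<le> c * (11 * c) ^ N / \<delta> \<Longrightarrow> 1 \<le> \<bar>q \<bullet> v\<bar>"
  shows "\<exists>s\<in>{0..1}. \<exists>l\<in>L. norm (x - s *\<^sub>R v - l) \<le> \<delta>"
proof -
  have c1: "c \<ge> 1" by (simp add: c)
  define a where "a = (\<lambda>i. c * (11 * c) ^ i)"
  have a1: "a i \<ge> 1" for i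
    using c1 one_le_power[of "11 * c" i] mult_mono[of 1 c 1 "(11 * c) ^ i"] by (simp add: a_def)
  have aSuc: "6 * c + (1 + 4 * c) * a i \<le> a (Suc i)" for i
  proof -
    have "6 * c \<le> 6 * c * a i" "1 * a i \<le> c * a i" using c1 a1[of i] by (auto simp del: mult_1)
    moreover have "a (Suc i) = 11 * c * a i" by (simp add: a_def)
    ultimately show ?thesis by (simp add: algebra_simps)
  qed
  have amono: "a i \<le> a (Suc i)" for i
  proof -
    have "0 \<le> c * a i" using c1 a1[of i] by (intro mult_nonneg_nonneg) auto
    then show ?thesis using aSuc[of i] c1 by (simp add: algebra_simps)
  qed
  define H where "H = (\<lambda>i. \<forall>q\<in>dual_in UNIV L. q \<noteq> 0 \<longrightarrow> norm q \<le> a i / \<delta> \<longrightarrow> 2 ^ (N - i) \<le> \<bar>q \<bullet> v\<bar>)"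
  have HN: "H N" using cond by (auto simp: H_def a_def)
  show ?thesis
  proof (cases "H 0")
    case True
    have "c \<le> \<delta> * norm q \<or> 2 * c \<le> \<bar>q \<bullet> v\<bar>" if q: "q \<in> dual_in UNIV L" "q \<noteq> 0" for q
    proof (cases "norm q \<le> c / \<delta>")
      case True
      then have "2 ^ N \<le> \<bar>q \<bullet> v\<bar>" using \<open>H 0\<close> q by (simp add: H_def a_def)
      then show ?thesis using N by linarith
    next
      case False
      then show ?thesis using \<delta> by (simp add: field_simps)
    qed
    then show ?thesis
      using segment_ball_cover[OF lat _ \<delta>, of v c x] c by simp
  next
    case False
    then obtain i where i: "i < N" "H (Suc i)" "\<not> H i"
      using inc_induct[of 0 N H] HN by blast
    then obtain p1 where p1: "p1 \<in> dual_in UNIV L" "p1 \<noteq> 0" "norm p1 \<le> a i / \<delta>" "\<bar>p1 \<bullet> v\<bar> < 2 ^ (N - i)"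
      by (auto simp: H_def not_le)
    define M :: real where "M = 2 ^ (N - Suc i)"
    have M: "M \<ge> 1" "2 ^ (N - i) = 2 * M"
      using i(1) by (simp_all add: M_def flip: power_Suc)
    define w where "w = (1 / M) *\<^sub>R v"
    have H1: "1 \<le> \<bar>q \<bullet> w\<bar>" if "q \<in> dual_in UNIV L" "q \<noteq> 0" "norm q \<le> a (Suc i) / \<delta>" for q
      using i(2) that M(1) by (auto simp: H_def w_def M_def[symmetric] field_simps)
    define p2 where "p2 = (if p1 \<bullet> w \<ge> 0 then p1 else 0 - p1)"
    have p2: "p2 \<in> dual_in UNIV L" "p2 \<noteq> 0" "norm p2 \<le> a i / \<delta>" "0 \<le> p2 \<bullet> w" "p2 \<bullet> w < 2"
      using p1 M dual_in_diff[OF lat dual_in_0[OF lat], of p1] by (auto simp: p2_def w_def field_simps)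
    obtain m :: nat and b where m: "m \<ge> 1" "p2 /\<^sub>R of_nat m \<in> dual_in UNIV L" "b \<in> L" "(p2 /\<^sub>R of_nat m) \<bullet> b = 1"
      using dual_in_primitive[OF lat p2(1,2)] by metis
    \<comment> \<open>Passing to the primitive vector only shrinks the norm and the value at
      \<open>w\<close>; since \<open>p\<close> is still in the larger ball, that value cannot drop
      below 1.\<close>
    define p where "p = p2 /\<^sub>R of_nat m"
    have "norm p \<le> norm p2"
      using m(1) mult_right_mono[of 1 "real m" "norm p2"] by (simp add: p_def field_simps)
    then have np: "norm p \<le> a i / \<delta>" using p2(3) by linarith
    also have "\<dots> \<le> a (Suc i) / \<delta>" using amono \<delta> by (intro divide_right_mono) auto
    finally have "1 \<le> \<bar>p \<bullet> w\<bar>" using H1[of p] m(1,2) p2(2) by (simp add: p_def)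
    moreover have "0 \<le> p \<bullet> w" using p2(4) by (simp add: p_def)
    ultimately have pw1: "1 \<le> p \<bullet> w" by simp
    have "p \<bullet> w \<le> p2 \<bullet> w"
      using m(1) mult_right_mono[of 1 "real m" "p2 \<bullet> w"] p2(4) by (simp add: p_def field_simps)
    then have pw2: "p \<bullet> w < 2" using p2(5) by linarith
    have "6 * c / \<delta> + (1 + 4 * c) * norm p \<le> 6 * c / \<delta> + (1 + 4 * c) * (a i / \<delta>)"
      using np c1 by (intro add_left_mono mult_left_mono) auto
    also have "\<dots> = (6 * c + (1 + 4 * c) * a i) / \<delta>" by (simp add: add_divide_distrib)
    also have "\<dots> \<le> a (Suc i) / \<delta>" using aSuc \<delta> by (intro divide_right_mono) auto
    finally have R: "6 * c / \<delta> + (1 + 4 * c) * norm p \<le> a (Suc i) / \<delta>" .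
    obtain s l where sl: "s \<in> {0..1}" "l \<in> L" "norm (x - s *\<^sub>R w - l) \<le> \<delta>"
      using segment_ball_cover_step[OF lat m(2,3,4)[folded p_def] pw1 pw2 \<delta> _ R H1] c by blast
    \<comment> \<open>The covering found for the shorter segment \<open>w\<close> uses only an
      initial part of the segment \<open>v\<close>.\<close>
    have "s / M \<le> 1" using sl(1) M(1) by (simp add: field_simps)
    then have "s / M \<in> {0..1}" using sl(1) M(1) by auto
    moreover have "norm (x - (s / M) *\<^sub>R v - l) \<le> \<delta>" using sl(3) by (simp add: w_def)
    ultimately show ?thesis using sl(2) by blast
  qed
qed

section \<open>Finite covolume forces full rank\<close>

text \<open>If a discrete group does not span, translates of a tube of infinite volume orthogonal to it
  are pairwise disjoint, so no set of finite measure can cover.\<close>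

lemma emeasure_lebesgue_translation:
  fixes S :: "'a::euclidean_space set"
  shows "emeasure lebesgue ((+) a ` S) = emeasure lebesgue S"
  using emeasure_lebesgue_affine[of 1 a S] by (simp add: ac_simps cong: image_cong_simp)

lemma countable_separated:
  fixes L :: "'a::euclidean_space set"
  assumes "r > 0" "\<And>x y. x \<in> L \<Longrightarrow> y \<in> L \<Longrightarrow> x \<noteq> y \<Longrightarrow> r \<le> dist x y"
  shows "countable L"
proof -
  define B where "B = (\<lambda>x::'a. ball x (r/2))"
  have disj: "disjnt (B x) (B y)" if "x \<in> L" "y \<in> L" "x \<noteq> y" for x y
  proof -
    have False if "z \<in> B x" "z \<in> B y" for z
      using that assms(2)[OF \<open>x \<in> L\<close> \<open>y \<in> L\<close> \<open>x \<noteq> y\<close>] dist_triangle_half_l[of x z r y]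
      by (auto simp: B_def dist_commute)
    then show ?thesis by (auto simp: disjnt_def)
  qed
  have "countable (B ` L)"
    using disj by (intro countable_disjoint_open_subsets) (auto simp: B_def pairwise_def)
  moreover have "inj_on B L"
  proof (rule inj_onI, rule ccontr)
    fix x y assume "x \<in> L" "y \<in> L" "B x = B y" "x \<noteq> y"
    then show False using disj[of x y] assms(1) by (auto simp: B_def)
  qed
  ultimately show ?thesis using countable_image_inj_on by blast
qed

text \<open>Cut \<open>D\<close> into pieces according to the lattice vector that moves a point into
  \<open>F\<close>. The moved pieces are disjoint in \<open>F\<close> by \<open>sep\<close>, and
  translation preserves measure.\<close>

lemma emeasure_le_covering_set:
  fixes L D F :: "'a::euclidean_space set"
  assumes L: "countable L" and D: "D \<in> sets lebesgue" and F: "F \<in> sets lebesgue"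
    and sep: "\<And>x y k l. x \<in> D \<Longrightarrow> y \<in> D \<Longrightarrow> k \<in> L \<Longrightarrow> l \<in> L \<Longrightarrow> x - k = y - l \<Longrightarrow> k = l"
    and cover: "\<And>x. x \<in> D \<Longrightarrow> \<exists>f\<in>F. \<exists>l\<in>L. x = f + l"
  shows "emeasure lebesgue D \<le> emeasure lebesgue F"
proof -
  define J where "J = to_nat_on L ` L"
  define g where "g = from_nat_into L"
  have gL: "g n \<in> L" if "n \<in> J" for n
    using that L by (auto simp: J_def g_def)
  have ginj: "n = n'" if "n \<in> J" "n' \<in> J" "g n = g n'" for n n'
    using that L by (auto simp: J_def g_def)
  have gsurj: "\<exists>n\<in>J. g n = l" if "l \<in> L" for l
    using that L by (auto simp: J_def g_def)
  \<comment> \<open>Outside \<open>J\<close> the enumeration \<open>g\<close> only returns a default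
    element; taking \<open>Y\<close> empty there keeps the family disjoint when \<open>L\<close> is
    finite.\<close>
  define Y where "Y = (\<lambda>n. if n \<in> J then (+) (- g n) ` D \<inter> F else {})"
  have Ysets: "range Y \<subseteq> sets lebesgue"
    using lebesgue_sets_translation[OF D] F unfolding Y_def by (intro image_subsetI) (simp only: sets.Int sets.empty_sets split: if_split, blast)
  have Xsets: "range (\<lambda>n. (+) (g n) ` Y n) \<subseteq> sets lebesgue"
    using Ysets by (auto intro!: lebesgue_sets_translation)
  have disj: "disjoint_family Y"
  proof -
    have False if "n \<noteq> n'" "z \<in> Y n" "z \<in> Y n'" for n n' z
    proof -
      have J: "n \<in> J" "n' \<in> J" using that by (auto simp: Y_def split: if_splits)
      with that(2,3) obtain x y where xy: "x \<in> D" "y \<in> D" "z = - g n + x" "z = - g n' + y"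
        unfolding Y_def by fastforce
      then show False using sep[of x y "g n" "g n'"] gL J ginj that(1) by (auto simp: algebra_simps)
    qed
    then show ?thesis by (auto simp: disjoint_family_on_def)
  qed
  have sub: "D \<subseteq> (\<Union>n. (+) (g n) ` Y n)"
  proof
    fix x assume x: "x \<in> D"
    then obtain f l where fl: "f \<in> F" "l \<in> L" "x = f + l" using cover by blast
    then obtain n where n: "n \<in> J" "g n = l" using gsurj by blast
    have "f = - g n + x" using fl n by simp
    then have "f \<in> (+) (- g n) ` D" using x by (rule image_eqI)
    then have "f \<in> Y n" using fl(1) n(1) by (simp only: Y_def if_True Int_iff simp_thms)
    then have "x \<in> (+) (g n) ` Y n" using fl n by (auto simp: add.commute)
    then show "x \<in> (\<Union>n. (+) (g n) ` Y n)" by blast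
  qed
  have "emeasure lebesgue D \<le> emeasure lebesgue (\<Union>n. (+) (g n) ` Y n)"
    using sub Xsets by (intro emeasure_mono) auto
  also have "\<dots> \<le> (\<Sum>n. emeasure lebesgue ((+) (g n) ` Y n))"
    by (rule emeasure_subadditive_countably[OF Xsets])
  also have "\<dots> = (\<Sum>n. emeasure lebesgue (Y n))"
    by (simp add: emeasure_lebesgue_translation)
  also have "\<dots> = emeasure lebesgue (\<Union>n. Y n)" by (rule suminf_emeasure[OF Ysets disj])
  also have "\<dots> \<le> emeasure lebesgue F" using F by (intro emeasure_mono) (auto simp: Y_def split: if_splits)
  finally show ?thesis .
qed

text \<open>The open slices between consecutive integer heights along \<open>p\<close> are disjoint
  translates of one nonempty open set, so the tube contains infinitely many pieces of equal positive
  measure.\<close>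

lemma emeasure_tube:
  fixes p :: "'a::euclidean_space"
  assumes p: "p \<noteq> 0" and r: "r > 0"
  defines "D \<equiv> {x. norm (x - ((p \<bullet> x) / (p \<bullet> p)) *\<^sub>R p) < r}"
  shows "D \<in> sets lebesgue" "emeasure lebesgue D = \<infinity>"
proof -
  have pp: "p \<bullet> p \<noteq> 0" using p by simp
  have oD: "open D" unfolding D_def by (intro open_Collect_less continuous_intros) (use pp in auto)
  then show Ds: "D \<in> sets lebesgue" by simp
  define T where "T = (\<lambda>n::nat. D \<inter> {x. real n < (p \<bullet> x) / (p \<bullet> p)} \<inter> {x. (p \<bullet> x) / (p \<bullet> p) < real n + 1})"
  have oT: "open (T n)" for n
    unfolding T_def using oD by (intro open_Int open_Collect_less continuous_intros) (use pp in auto)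
  have Tsets: "range T \<subseteq> sets lebesgue" using oT by auto
  have disj: "disjoint_family T"
  proof -
    have "n = n'" if "z \<in> T n" "z \<in> T n'" for n n' z
    proof -
      have "real n < real n' + 1" "real n' < real n + 1" using that unfolding T_def by force+
      then show ?thesis by linarith
    qed
    then show ?thesis unfolding disjoint_family_on_def by blast
  qed
  have shift: "T n = (+) (real n *\<^sub>R p) ` T 0" for n
  proof -
    have *: "(p \<bullet> (x + t *\<^sub>R p)) / (p \<bullet> p) = (p \<bullet> x) / (p \<bullet> p) + t" for x t
      using pp by (simp add: inner_add_right add_divide_distrib)
    have mem: "x \<in> T n \<longleftrightarrow> x + (- real n) *\<^sub>R p \<in> T 0" for x
      unfolding T_def D_def Int_iff mem_Collect_eq * by (simp add: algebra_simps)
    show ?thesis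
    proof (intro set_eqI iffI)
      fix x assume "x \<in> T n"
      then show "x \<in> (+) (real n *\<^sub>R p) ` T 0"
        unfolding mem by (rule image_eqI[rotated]) simp
    qed (auto simp: mem)
  qed
  have "(1/2) *\<^sub>R p \<in> T 0" using pp r by (auto simp: T_def D_def)
  then have "\<not> negligible (T 0)" using open_not_negligible[OF oT] by blast
  then have pos: "emeasure lebesgue (T 0) \<noteq> 0" using negligible_iff_emeasure0 Tsets by blast
  have "(\<Sum>n. emeasure lebesgue (T n)) = (\<Sum>n::nat. emeasure lebesgue (T 0))"
    by (subst shift) (simp add: emeasure_lebesgue_translation)
  also have "\<dots> = \<infinity>"
    using pos by (simp add: nn_integral_count_space_nat[symmetric] ennreal_mult_top)
  finally have "emeasure lebesgue (\<Union>n. T n) = \<infinity>" using suminf_emeasure[OF Tsets disj] by simp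
  moreover have "emeasure lebesgue (\<Union>n. T n) \<le> emeasure lebesgue D"
    using Ds by (intro emeasure_mono) (auto simp: T_def)
  ultimately show "emeasure lebesgue D = \<infinity>" by (simp add: top.extremum_unique)
qed

lemma is_lattice_imp_lattice_in:
  fixes L :: "(real ^ 'n) set"
  assumes "is_lattice L"
  shows "lattice_in UNIV L"
proof -
  obtain r F where L: "0 \<in> L" "\<And>x y. x \<in> L \<Longrightarrow> y \<in> L \<Longrightarrow> x - y \<in> L"
    and r: "r > 0" "\<And>x. x \<in> L \<Longrightarrow> x \<noteq> 0 \<Longrightarrow> r \<le> norm x"
    and F: "F \<in> sets lebesgue" "emeasure lebesgue F < \<infinity>" "\<And>x. \<exists>f\<in>F. \<exists>l\<in>L. x = f + l"
    using assms unfolding is_lattice_def by blast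
  have "span L = UNIV"
  proof (rule ccontr)
    assume "span L \<noteq> UNIV"
    then obtain p where p: "p \<noteq> 0" "\<And>x. x \<in> L \<Longrightarrow> p \<bullet> x = 0"
      using span_not_UNIV_orthogonal by (metis span_base)
    \<comment> \<open>Radius \<open>r / 2\<close> makes translates disjoint: two points of the tube
      that differ by a lattice vector, which is orthogonal to \<open>p\<close>, differ by less than
      \<open>r\<close>.\<close>
    define D where "D = {x. norm (x - ((p \<bullet> x) / (p \<bullet> p)) *\<^sub>R p) < r / 2}"
    note tube = emeasure_tube[OF p(1) half_gt_zero[OF r(1)], folded D_def]
    have "countable L"
      using r L by (intro countable_separated[of r]) (auto simp: dist_norm)
    moreover have "k = l" if "x \<in> D" "y \<in> D" "k \<in> L" "l \<in> L" "x - k = y - l" for x y k l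
    proof (rule ccontr)
      assume "k \<noteq> l"
      then have "r \<le> norm (k - l)" using r(2) L(2) that by auto
      moreover have xy: "x = y + (k - l)" using that(5) by (simp add: algebra_simps)
      have "p \<bullet> x = p \<bullet> y" using p(2) that by (simp add: xy inner_add_right inner_diff_right)
      then have "k - l = (x - ((p \<bullet> x) / (p \<bullet> p)) *\<^sub>R p) - (y - ((p \<bullet> y) / (p \<bullet> p)) *\<^sub>R p)"
        using xy by simp
      then have "norm (k - l) < r / 2 + r / 2"
        using that(1,2) norm_triangle_ineq4[of "x - ((p \<bullet> x) / (p \<bullet> p)) *\<^sub>R p" "y - ((p \<bullet> y) / (p \<bullet> p)) *\<^sub>R p"]
        unfolding D_def by simp
      ultimately show False by simp
    qed
    ultimately have "emeasure lebesgue D \<le> emeasure lebesgue F"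
      using F tube(1) by (intro emeasure_le_covering_set[of L]) auto
    then show False using tube(2) F(2) by (simp add: top.extremum_unique)
  qed
  then show ?thesis using L r by (auto simp: lattice_in_def)
qed

section \<open>From coverings to the covering time\<close>

lemma Tcov_le:
  assumes "t \<ge> 0" "\<And>x. \<exists>s\<in>{0..t}. \<exists>l\<in>L. norm (x - s *\<^sub>R \<Omega> - l) \<le> \<delta>"
  shows "Tcov L \<Omega> \<delta> \<le> ereal t"
proof -
  have "infdist x (orbit_set L \<Omega> t) \<le> \<delta>" for x
  proof -
    obtain s l where "s \<in> {0..t}" "l \<in> L" "norm (x - s *\<^sub>R \<Omega> - l) \<le> \<delta>" using assms(2) by blast
    then have "s *\<^sub>R \<Omega> + l \<in> orbit_set L \<Omega> t" "dist x (s *\<^sub>R \<Omega> + l) \<le> \<delta>"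
      by (auto simp: orbit_set_def dist_norm algebra_simps)
    then show ?thesis using infdist_le[of _ "orbit_set L \<Omega> t" x] order_trans by blast
  qed
  then show ?thesis unfolding Tcov_def using assms(1) by (intro Inf_lower) auto
qed

theorem theorem4p2:
  "\<exists>a::real. a > 0 \<and>
     (\<forall>(L::(real ^ 'n) set) (\<Omega>::real ^ 'n) (\<delta>::real).
        is_lattice L \<longrightarrow> \<delta> > 0 \<longrightarrow> Tcov L \<Omega> \<delta> \<le> inv_conv (alpha L \<Omega> (a / \<delta>)))"
proof -
  define c :: real where "c = 3 ^ DIM(real ^ 'n)"
  obtain N where N: "2 * c < 2 ^ N" using real_arch_pow[of 2 "2 * c"] by auto
  \<comment> \<open>The largest radius of the chain in \<open>segment_ball_cover_dual_ball\<close>;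
    it depends on the dimension alone.\<close>
  define a where "a = c * (11 * c) ^ N"
  have a0: "a > 0" by (simp add: a_def c_def)
  have "Tcov L \<Omega> \<delta> \<le> inv_conv (alpha L \<Omega> (a / \<delta>))"
    if L: "is_lattice L" and \<delta>: "\<delta> > 0" for L :: "(real ^ 'n) set" and \<Omega> \<delta>
  proof -
    have lat: "lattice_in UNIV L" by (rule is_lattice_imp_lattice_in[OF L])
    define A where "A = alpha L \<Omega> (a / \<delta>)"
    have A: "A \<le> ereal \<bar>q \<bullet> \<Omega>\<bar>" if "q \<in> dual_in UNIV L" "q \<noteq> 0" "norm q \<le> a / \<delta>" for q
      unfolding A_def alpha_def using that
      by (intro Inf_lower) (auto simp: dual_ball_def dual_lattice_def dual_in_def)
    have A0: "A \<ge> 0" unfolding A_def alpha_def by (intro Inf_greatest) auto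
    show ?thesis
    proof (cases "A = 0")
      case True
      then show ?thesis by (simp add: A_def inv_conv_def)
    next
      case A_nz: False
      \<comment> \<open>When \<open>A\<close> is infinite no nonzero dual vector lies in the ball,
        so the bound required of \<open>t *\<^sub>R \<Omega>\<close> is vacuous and time 0
        suffices.\<close>
      define t where "t = (if A = \<infinity> then 0 else 1 / real_of_ereal A)"
      have t0: "t \<ge> 0" using A0 by (simp add: t_def real_of_ereal_pos)
      have inv: "inv_conv A = ereal t" using A_nz by (simp add: inv_conv_def t_def)
      have "1 \<le> \<bar>q \<bullet> (t *\<^sub>R \<Omega>)\<bar>" if q: "q \<in> dual_in UNIV L" "q \<noteq> 0" "norm q \<le> a / \<delta>" for q
      proof -
        have "A \<noteq> \<infinity>" using A[OF q] by auto
        then obtain \<alpha> where \<alpha>: "A = ereal \<alpha>" "\<alpha> > 0" using A0 A_nz by (cases A) auto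
        then show ?thesis using A[OF q] by (simp add: t_def abs_mult field_simps)
      qed
      then have cover: "\<exists>s\<in>{0..1}. \<exists>l\<in>L. norm (x - s *\<^sub>R (t *\<^sub>R \<Omega>) - l) \<le> \<delta>" for x
        using segment_ball_cover_dual_ball[OF lat \<delta> c_def less_imp_le[OF N], of "t *\<^sub>R \<Omega>" x]
        by (simp add: a_def)
      have "\<exists>s\<in>{0..t}. \<exists>l\<in>L. norm (x - s *\<^sub>R \<Omega> - l) \<le> \<delta>" for x
      proof -
        obtain s l where "s \<in> {0..1}" "l \<in> L" "norm (x - s *\<^sub>R (t *\<^sub>R \<Omega>) - l) \<le> \<delta>" using cover by blast
        moreover from this have "s * t \<in> {0..t}" using t0 by (auto simp: mult_left_le_one_le)
        ultimately show ?thesis by (intro bexI[of _ "s * t"] bexI[of _ l]) auto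
      qed
      then show ?thesis using Tcov_le[OF t0, of L \<Omega> \<delta>] inv by (simp add: A_def)
    qed
  qed
  then show ?thesis using a0 by blast
qed

end
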